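(* Let $0<\alpha<1-\frac{\sqrt{2}}{2}$. If $f\in\mathcal{S}(\mathbb{R})$ is such that $f(\pm n^{\alpha})=\widehat{f}(\pm n^{\alpha})=0$ for each $n\in\mathbb{N}$, then $f\equiv 0$.
   Context: The Fourier transform of an integrable function $f:\mathbb{R}\to\mathbb{C}$ is normalised as $\widehat{f}(\xi)=\int_{\mathbb{R}} f(x)e^{2\pi i x\xi}\,\mathrm{d}x$. $\mathcal{S}(\mathbb{R})$ denotes the Schwartz class of functions $\mathbb{R}\to\mathbb{C}$. $\mathbb{N}=\{0,1,2,\dots\}$. *)

theory Defs
  imports "HOL-Analysis.Analysis"
begin

definition nth_vderiv :: "nat \<Rightarrow> (real \<Rightarrow> complex) \<Rightarrow> real \<Rightarrow> complex" where
  "nth_vderiv k f = ((\<lambda>g x. vector_derivative g (at x)) ^^ k) f"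

text \<open>Differentiability of every iterated derivative is required explicitly, because
  \<^const>\<open>vector_derivative\<close> is an arbitrary value where the derivative does not exist.\<close>

definition schwartz :: "(real \<Rightarrow> complex) set" where
  "schwartz = {f. (\<forall>k x. nth_vderiv k f differentiable at x) \<and>
                  (\<forall>j k. bounded (range (\<lambda>x. \<bar>x\<bar> ^ j *\<^sub>R nth_vderiv k f x)))}"

text \<open>The exponent carries a plus sign: this is the normalisation intended here.\<close>

definition fourier :: "(real \<Rightarrow> complex) \<Rightarrow> real \<Rightarrow> complex" where
  "fourier f \<xi> = (LINT x|lborel. f x * exp (2 * of_real pi * \<i> * of_real x * of_real \<xi>))"

end

theory Submission
  imports Defs "HOL-Probability.Probability"
begin

text \<open>If \<open>H = fourier h\<close> vanishes at \<open>k\<close> points \<open>z\<close>, then the interpolation error bounds \<open>\<bar>H x\<bar>\<close> by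
  \<open>2 \<Prod>\<bar>x - z\<bar> / fact k\<close> times the supremum of the \<open>k\<close>-th derivative of \<open>H\<close>, hence times \<open>(2 * pi) ^ k\<close> times the
  \<open>k\<close>-th absolute moment of \<open>h\<close>. Near \<open>x\<close> the points \<open>n powr \<alpha>\<close> have gaps at most \<open>1 / x\<^sup>2\<close> because
  \<open>\<alpha> \<le> 1 / 3\<close>, so \<open>\<bar>H x\<bar> * x ^ (2 * k)\<close> is at most \<open>2 * (2 * pi) ^ k\<close> times the \<open>k\<close>-th moment of \<open>h\<close>.
  Applied to \<open>f\<close> and to \<open>fourier f\<close>, whose transform is the reflection of \<open>f\<close>, this bounds the moments
  of order \<open>2 * k - 2\<close> of the pair by those of order \<open>k\<close>, and by iteration the moments grow at most
  exponentially. Hence \<open>f\<close> vanishes outside a bounded interval; interpolating at \<open>k\<close> points of an interval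
  where \<open>f\<close> vanishes and letting \<open>k\<close> tend to infinity shows that it vanishes everywhere.\<close>

section \<open>Interpolation error\<close>

text \<open>Induction adds the zeros in increasing order, and Rolle between the last two gives one
  new critical point. The clause that every \<open>w\<close> lies below some \<open>z\<close> is
  carried along to keep that point distinct from the earlier ones.\<close>

lemma rolle_finite_zeros:
  fixes g g' :: "real \<Rightarrow> real"
  assumes deriv: "\<And>x. (g has_real_derivative g' x) (at x)"
    and "finite Z" "\<And>z. z \<in> Z \<Longrightarrow> g z = 0"
  shows "\<exists>W. finite W \<and> card W = card Z - 1 \<and> (\<forall>w\<in>W. g' w = 0) \<and> (\<forall>w\<in>W. \<exists>z\<in>Z. w < z)"
  using assms(2,3)
proof (induction rule: finite_linorder_max_induct)
  case empty
  show ?case by (intro exI[of _ "{}"]) simp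
next
  case (insert b A)
  show ?case
  proof (cases "A = {}")
    case True
    then show ?thesis by (intro exI[of _ "{}"]) simp
  next
    case False
    obtain W where W: "finite W" "card W = card A - 1" "\<forall>w\<in>W. g' w = 0" "\<forall>w\<in>W. \<exists>z\<in>A. w < z"
      using insert by auto
    define a where "a = Max A"
    have aA: "a \<in> A" "a < b" using False insert by (auto simp: a_def)
    have le: "z \<le> a" if "z \<in> A" for z using that insert by (auto simp: a_def)
    have "\<exists>c>a. c < b \<and> g' c = 0"
    proof -
      have "g a = g b" using insert.prems aA by simp
      moreover have "continuous_on {a..b} g"
        using deriv by (meson DERIV_isCont continuous_at_imp_continuous_on)
      ultimately obtain c where "a < c" "c < b" "(\<lambda>v. g' c * v) = (\<lambda>v. 0)"
        using Rolle_deriv[OF aA(2), of g "\<lambda>x v. g' x * v"] deriv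
        by (auto simp: has_field_derivative_def mult_commute_abs)
      then show ?thesis by (metis mult.right_neutral)
    qed
    then obtain c where c: "a < c" "c < b" "g' c = 0" by blast
    have "c \<notin> W" using W(4) le c by fastforce
    moreover have "b \<notin> A" using insert by auto
    moreover have "card A \<ge> 1" using False insert by (simp add: Suc_leI card_gt_0_iff)
    ultimately show ?thesis
      using W c insert.hyps by (intro exI[of _ "insert c W"]) (auto intro: less_imp_le)
  qed
qed

text \<open>Here \<open>g i\<close> plays the \<open>i\<close>-th derivative of \<open>g 0\<close>.
  Each use of Rolle costs one zero, so \<open>Suc k\<close> zeros leave one after \<open>k\<close>
  differentiations.\<close>

lemma iterated_rolle:
  fixes g :: "nat \<Rightarrow> real \<Rightarrow> real"
  assumes "\<And>i x. (g i has_real_derivative g (Suc i) x) (at x)"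
    and "finite Z" "card Z = Suc k" "\<And>z. z \<in> Z \<Longrightarrow> g 0 z = 0"
  shows "\<exists>w. g k w = 0"
  using assms
proof (induction k arbitrary: g Z)
  case 0
  then show ?case by (metis card_1_singletonE insertI1 One_nat_def)
next
  case (Suc k)
  obtain W where W: "finite W" "card W = card Z - 1" "\<forall>w\<in>W. g 1 w = 0"
    using rolle_finite_zeros[of "g 0" "g 1" Z] Suc.prems by auto
  have "\<exists>w. g (Suc k) w = 0"
    by (rule Suc.IH[of "\<lambda>i. g (Suc i)" W]) (use W Suc.prems in auto)
  then show ?case .
qed

lemma higher_pderiv_degree_monic:
  fixes p :: "real poly"
  assumes "lead_coeff p = 1"
  shows "poly ((pderiv ^^ degree p) p) x = fact (degree p)"
proof -
  have "(pderiv ^^ degree p) p = [:fact (degree p):]"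
  proof (rule poly_eqI)
    fix n
    show "coeff ((pderiv ^^ degree p) p) n = coeff [:fact (degree p):] n"
      using assms
      by (cases n) (simp_all add: coeff_higher_pderiv coeff_eq_0 pochhammer_fact flip: fact_numeral)
  qed
  then show ?thesis by simp
qed

text \<open>The classical error argument for polynomial interpolation, with interpolant zero:
  subtracting a multiple of the nodal polynomial makes \<open>x\<close> an additional zero, and
  iterated Rolle then evaluates the multiplier.\<close>

lemma real_interpolation_error:
  fixes g :: "nat \<Rightarrow> real \<Rightarrow> real"
  assumes deriv: "\<And>i x. (g i has_real_derivative g (Suc i) x) (at x)"
    and Z: "finite Z" "card Z = k" "\<And>z. z \<in> Z \<Longrightarrow> g 0 z = 0"
    and M: "\<And>x. \<bar>g k x\<bar> \<le> M"
  shows "\<bar>g 0 x\<bar> \<le> (\<Prod>z\<in>Z. \<bar>x - z\<bar>) / fact k * M"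
proof (cases "x \<in> Z")
  case True
  have "0 \<le> M" using M[of 0] by linarith
  with True Z show ?thesis by (simp add: prod_nonneg)
next
  case False
  define P where "P = (\<Prod>z\<in>Z. [:-z, 1:])"
  have poly_P: "poly P y = (\<Prod>z\<in>Z. y - z)" for y
    by (simp add: P_def poly_prod algebra_simps)
  have lead: "lead_coeff P = 1"
    by (simp add: P_def lead_coeff_prod)
  have deg: "degree P = k"
    using Z by (simp add: P_def degree_prod_eq_sum_degree)
  have nz: "poly P x \<noteq> 0" using False Z by (auto simp: poly_P)
  \<comment> \<open>This choice makes \<open>G 0\<close> vanish at \<open>x\<close> too. Since
    \<open>P\<close> is monic of degree \<open>k\<close>, its \<open>k\<close>-th derivative is the
    constant \<open>fact k\<close>, so a zero \<open>w\<close> of \<open>G k\<close> gives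
    \<open>c = g k w / fact k\<close>.\<close>
  define c where "c = g 0 x / poly P x"
  define G where "G i y = g i y - c * poly ((pderiv ^^ i) P) y" for i y
  have "\<exists>w. G k w = 0"
  proof (rule iterated_rolle[of G "insert x Z"])
    show "(G i has_real_derivative G (Suc i) y) (at y)" for i y
      unfolding G_def by (auto intro!: derivative_eq_intros deriv poly_DERIV)
    show "G 0 z = 0" if "z \<in> insert x Z" for z
      using that Z nz by (auto simp: G_def c_def poly_P)
  qed (use Z False in auto)
  then obtain w where "g k w = c * fact k"
    using higher_pderiv_degree_monic[OF lead] by (auto simp: G_def deg)
  then have "\<bar>c\<bar> * fact k \<le> M" using M[of w] by (simp add: abs_mult)
  then have "\<bar>c\<bar> \<le> M / fact k" by (simp add: field_simps)
  then have "\<bar>poly P x\<bar> * \<bar>c\<bar> \<le> \<bar>poly P x\<bar> * (M / fact k)" by (rule mult_left_mono) simp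
  moreover have "\<bar>g 0 x\<bar> = \<bar>poly P x\<bar> * \<bar>c\<bar>" using nz by (simp add: c_def)
  ultimately show ?thesis by (simp add: poly_P abs_prod)
qed

text \<open>Rolle fails for complex values, so real and imaginary parts are treated separately;
  adding the two bounds gives the factor 2.\<close>

lemma complex_interpolation_error:
  fixes g :: "nat \<Rightarrow> real \<Rightarrow> complex"
  assumes deriv: "\<And>i x. (g i has_vector_derivative g (Suc i) x) (at x)"
    and Z: "finite Z" "card Z = k" "\<And>z. z \<in> Z \<Longrightarrow> g 0 z = 0"
    and M: "\<And>x. norm (g k x) \<le> M"
  shows "norm (g 0 x) \<le> 2 * (\<Prod>z\<in>Z. \<bar>x - z\<bar>) / fact k * M"
proof -
  have "\<bar>Re (g 0 x)\<bar> \<le> (\<Prod>z\<in>Z. \<bar>x - z\<bar>) / fact k * M"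
  proof (rule real_interpolation_error[where g = "\<lambda>i x. Re (g i x)"])
    show "((\<lambda>x. Re (g i x)) has_real_derivative Re (g (Suc i) x)) (at x)" for i x
      using deriv by (simp add: has_field_derivative_Re)
    show "\<bar>Re (g k x)\<bar> \<le> M" for x using M[of x] abs_Re_le_cmod order_trans by blast
  qed (use Z in auto)
  moreover have "\<bar>Im (g 0 x)\<bar> \<le> (\<Prod>z\<in>Z. \<bar>x - z\<bar>) / fact k * M"
  proof (rule real_interpolation_error[where g = "\<lambda>i x. Im (g i x)"])
    show "((\<lambda>x. Im (g i x)) has_real_derivative Im (g (Suc i) x)) (at x)" for i x
      using deriv by (simp add: has_field_derivative_Im)
    show "\<bar>Im (g k x)\<bar> \<le> M" for x using M[of x] abs_Im_le_cmod order_trans by blast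
  qed (use Z in auto)
  ultimately have "norm (g 0 x) \<le> 2 * ((\<Prod>z\<in>Z. \<bar>x - z\<bar>) / fact k * M)"
    using cmod_le[of "g 0 x"] by linarith
  then show ?thesis by simp
qed

section \<open>Fourier transforms of functions with finite moments\<close>

definition moment :: "nat \<Rightarrow> (real \<Rightarrow> complex) \<Rightarrow> real" where
  "moment k h = (LINT t|lborel. \<bar>t\<bar> ^ k * norm (h t))"

text \<open>Measurability of \<open>h\<close> is asked separately because integrability of the
  absolute moments only concerns \<open>norm (h t)\<close>.\<close>

definition finite_moments :: "(real \<Rightarrow> complex) \<Rightarrow> bool" where
  "finite_moments h \<longleftrightarrow> h \<in> borel_measurable borel \<and> (\<forall>k. integrable lborel (\<lambda>t. \<bar>t\<bar> ^ k * norm (h t)))"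

lemma fourier_iexp: "fourier h \<xi> = (LINT x|lborel. h x * iexp (2 * pi * x * \<xi>))"
  unfolding fourier_def by (intro Bochner_Integration.integral_cong) (simp_all add: algebra_simps)

lemma integrable_mult_iexp:
  fixes h :: "real \<Rightarrow> complex"
  assumes "integrable lborel h"
  shows "integrable lborel (\<lambda>x. h x * iexp (c * x * \<xi>))"
proof (rule Bochner_Integration.integrable_bound[OF assms])
  show "(\<lambda>x. h x * iexp (c * x * \<xi>)) \<in> borel_measurable lborel"
    using borel_measurable_integrable[OF assms] by measurable
qed (simp add: norm_mult)

lemma norm_fourier_le:
  assumes "integrable lborel h"
  shows "norm (fourier h \<xi>) \<le> (LINT x|lborel. norm (h x))"
  unfolding fourier_iexp
  by (rule order_trans[OF integral_norm_bound]) (simp add: norm_mult)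

text \<open>Second-order Taylor remainder at \<open>a\<close>: once \<open>iexp a\<close>, of
  modulus 1, is factored out, only the expansion at 0 remains.\<close>

lemma norm_iexp_diff_le:
  "norm (iexp b - iexp a - (b - a) *\<^sub>R (\<i> * iexp a)) \<le> (b - a)\<^sup>2 / 2"
proof -
  have "iexp b - iexp a - (b - a) *\<^sub>R (\<i> * iexp a) = iexp a * (iexp (b - a) - (1 + \<i> * of_real (b - a)))"
    by (simp add: algebra_simps exp_add[symmetric] scaleR_conv_of_real)
  then have "norm (iexp b - iexp a - (b - a) *\<^sub>R (\<i> * iexp a)) = norm (iexp (b - a) - (1 + \<i> * of_real (b - a)))"
    by (simp add: norm_mult)
  also have "\<dots> \<le> (b - a)\<^sup>2 / 2"
    using iexp_approx1[of "b - a" 1] by (simp add: fact_numeral power2_eq_square)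
  finally show ?thesis .
qed

text \<open>Differentiation under the integral: the pointwise Taylor remainder is at most a constant
  times \<open>t\<^sup>2 * norm (h t) * (y - x)\<^sup>2\<close>, so integrability of the second
  moment makes the integrated remainder quadratic in \<open>y - x\<close>.\<close>

lemma fourier_has_vector_derivative:
  assumes h: "integrable lborel h" "integrable lborel (\<lambda>t. t *\<^sub>R h t)" "integrable lborel (\<lambda>t. t\<^sup>2 *\<^sub>R h t)"
  shows "(fourier h has_vector_derivative fourier (\<lambda>t. 2 * pi * \<i> * t * h t) x) (at x)"
proof -
  define D where "D = fourier (\<lambda>t. 2 * pi * \<i> * t * h t) x"
  define K where "K = (LINT t|lborel. (2 * pi)\<^sup>2 / 2 * norm (t\<^sup>2 *\<^sub>R h t))"
  have h2: "integrable lborel (\<lambda>t. (2 * pi)\<^sup>2 / 2 * norm (t\<^sup>2 *\<^sub>R h t))"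
    using integrable_norm[OF h(3)] by (intro integrable_mult_right)
  have h1: "integrable lborel (\<lambda>t. 2 * pi * \<i> * t * h t)"
    using integrable_mult_right[OF h(2), of "2 * pi * \<i>"] by (simp add: scaleR_conv_of_real mult.assoc)
  have bound: "norm (fourier h y - fourier h x - (y - x) *\<^sub>R D) \<le> K * (y - x)\<^sup>2" for y
  proof -
    define F where "F t = h t * iexp (2 * pi * t * y) - h t * iexp (2 * pi * t * x)
        - (y - x) *\<^sub>R (2 * pi * \<i> * t * h t * iexp (2 * pi * t * x))" for t
    have intF: "integrable lborel F"
      unfolding F_def using integrable_mult_iexp[OF h(1), of "2 * pi"] integrable_mult_iexp[OF h1, of "2 * pi"]
      by auto
    have "fourier h y - fourier h x - (y - x) *\<^sub>R D = (LINT t|lborel. F t)"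
      unfolding F_def D_def fourier_iexp
      using integrable_mult_iexp[OF h(1), of "2 * pi"] integrable_mult_iexp[OF h1, of "2 * pi"] by simp
    moreover have "norm (LINT t|lborel. F t) \<le> (LINT t|lborel. (2 * pi)\<^sup>2 / 2 * norm (t\<^sup>2 *\<^sub>R h t) * (y - x)\<^sup>2)"
    proof (rule Bochner_Integration.integral_norm_bound_integral[OF intF])
      fix t :: real
      have "F t = h t * (iexp (2 * pi * t * y) - iexp (2 * pi * t * x)
          - (2 * pi * t * y - 2 * pi * t * x) *\<^sub>R (\<i> * iexp (2 * pi * t * x)))"
        by (simp add: F_def algebra_simps scaleR_conv_of_real)
      then have "norm (F t) \<le> norm (h t) * ((2 * pi * t * y - 2 * pi * t * x)\<^sup>2 / 2)"
        by (simp only: norm_mult) (intro mult_left_mono norm_iexp_diff_le norm_ge_zero)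
      also have "\<dots> = (2 * pi)\<^sup>2 / 2 * norm (t\<^sup>2 *\<^sub>R h t) * (y - x)\<^sup>2"
        by (simp add: power2_eq_square field_simps)
      finally show "norm (F t) \<le> (2 * pi)\<^sup>2 / 2 * norm (t\<^sup>2 *\<^sub>R h t) * (y - x)\<^sup>2" .
    qed (use h2 in auto)
    ultimately show ?thesis by (simp add: K_def)
  qed
  have "((\<lambda>y. norm ((fourier h y - fourier h x) - (y - x) *\<^sub>R D) / norm (y - x)) \<longlongrightarrow> 0) (at x)"
  proof (rule tendsto_sandwich[where f = "\<lambda>_. 0" and h = "\<lambda>y. K * \<bar>y - x\<bar>"])
    show "((\<lambda>y. K * \<bar>y - x\<bar>) \<longlongrightarrow> 0) (at x)"
      by (rule tendsto_eq_intros refl | simp)+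
    show "\<forall>\<^sub>F y in at x. norm ((fourier h y - fourier h x) - (y - x) *\<^sub>R D) / norm (y - x) \<le> K * \<bar>y - x\<bar>"
    proof (rule eventually_mono[OF eventually_neq_at_within[of x]])
      fix y assume "y \<noteq> x"
      then show "norm ((fourier h y - fourier h x) - (y - x) *\<^sub>R D) / norm (y - x) \<le> K * \<bar>y - x\<bar>"
        using bound[of y] by (simp add: pos_divide_le_eq mult.assoc power2_eq_square)
    qed
  qed auto
  then show ?thesis
    unfolding has_vector_derivative_def has_derivative_iff_norm D_def[symmetric]
    by (auto intro: bounded_linear_scaleR_left)
qed

lemma finite_moments_integrable:
  assumes "finite_moments h"
  shows "integrable lborel (\<lambda>t. (c * t) ^ k * h t)"
proof (rule Bochner_Integration.integrable_bound)
  show "integrable lborel (\<lambda>t. norm c ^ k * (\<bar>t\<bar> ^ k * norm (h t)))"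
    using assms by (simp add: finite_moments_def)
  have "h \<in> borel_measurable borel" using assms by (simp add: finite_moments_def)
  then show "(\<lambda>t. (c * t) ^ k * h t) \<in> borel_measurable lborel" by measurable
qed (simp add: norm_mult norm_power power_mult_distrib abs_mult)

lemma finite_moments_imp_integrable: "finite_moments h \<Longrightarrow> integrable lborel h"
  using finite_moments_integrable[of h 1 0] by simp

text \<open>Each differentiation brings down a factor \<open>2 * pi * \<i> * t\<close>, so these
  transforms form the sequence of successive derivatives that the interpolation bound takes.\<close>

lemma finite_moments_higher_derivative:
  assumes "finite_moments h"
  shows "(fourier (\<lambda>t. (2 * pi * \<i> * t) ^ k * h t) has_vector_derivative
      fourier (\<lambda>t. (2 * pi * \<i> * t) ^ Suc k * h t) x) (at x)"
proof -
  let ?c = "2 * pi * \<i>"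
  have "integrable lborel (\<lambda>t. t ^ j *\<^sub>R ((?c * t) ^ k * h t))" for j
  proof -
    have "(\<lambda>t. t ^ j *\<^sub>R ((?c * t) ^ k * h t)) = (\<lambda>t. ?c ^ k * ((1 * t) ^ (j + k) * h t))"
      by (auto simp: scaleR_conv_of_real power_mult_distrib power_add)
    then show ?thesis using finite_moments_integrable[OF assms, of 1 "j + k"] by simp
  qed
  note int = this
  show ?thesis
    using fourier_has_vector_derivative[of "\<lambda>t. (?c * t) ^ k * h t" x] int[of 0] int[of 1] int[of 2]
    by (simp add: mult.assoc)
qed

lemma finite_moments_fourier_measurable:
  assumes "finite_moments h"
  shows "fourier h \<in> borel_measurable borel"
proof (rule borel_measurable_continuous_onI)
  show "continuous_on UNIV (fourier h)"
    using finite_moments_higher_derivative[OF assms, of 0]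
    by (auto intro!: continuous_at_imp_continuous_on has_vector_derivative_continuous)
qed

lemma moment_nonneg: "0 \<le> moment k h"
  unfolding moment_def by (rule integral_nonneg_AE) simp

section \<open>Fourier inversion\<close>

lemma LBINT_std_normal_iexp:
  "(LINT u|lborel. of_real (std_normal_density u) * iexp (s * u)) = of_real (exp (- s\<^sup>2 / 2))"
proof -
  have "char std_normal_distribution s = (LINT u|lborel. std_normal_density u *\<^sub>R iexp (s * u))"
    unfolding char_def by (subst integral_density) auto
  then show ?thesis
    by (simp add: char_std_normal_distribution scaleR_conv_of_real)
qed

text \<open>The transform of a Gaussian of width \<open>a\<close> is expressed through
  \<open>std_normal_density\<close> again, so that it can serve as an averaging kernel of width
  proportional to \<open>1 / a\<close>.\<close>

lemma LBINT_scaled_normal_iexp: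
  fixes a :: real
  assumes "0 < a"
  shows "(LINT \<xi>|lborel. of_real (std_normal_density (\<xi> / a)) * iexp (s * \<xi>))
    = of_real (a * sqrt (2 * pi) * std_normal_density (a * s))"
proof -
  have "(LINT \<xi>|lborel. of_real (std_normal_density (\<xi> / a)) * iexp (s * \<xi>))
     = a *\<^sub>R (LINT u|lborel. of_real (std_normal_density u) * iexp (s * a * u))"
    using assms lborel_integral_real_affine[of a "\<lambda>\<xi>. of_real (std_normal_density (\<xi> / a)) * iexp (s * \<xi>)" 0]
    by (simp add: mult.assoc)
  also have "\<dots> = of_real (a * sqrt (2 * pi) * std_normal_density (a * s))"
    unfolding LBINT_std_normal_iexp
    by (simp add: std_normal_density_def scaleR_conv_of_real mult.commute)
  finally show ?thesis .
qed

text \<open>A Gaussian factor in the frequency turns inversion into an approximate identity.\<close>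

lemma gaussian_regularized_inversion:
  assumes f: "integrable lborel f" and a: "0 < a"
  shows "(LINT \<xi>|lborel. fourier f \<xi> * iexp (2 * pi * \<xi> * (- y)) * of_real (sqrt (2 * pi) * std_normal_density (\<xi> / a)))
    = (LINT v|lborel. std_normal_density v *\<^sub>R f (y + v / (2 * pi * a)))"
proof -
  \<comment> \<open>The Gaussian factor supplies integrability in \<open>\<xi>\<close>; without it
    the norm of the integrand would not depend on \<open>\<xi>\<close>, leaving no decay for
    Fubini.\<close>
  define F where "F x \<xi> = f x * iexp (2 * pi * (x - y) * \<xi>) * of_real (std_normal_density (\<xi> / a))" for x \<xi>
  have f_meas [measurable]: "f \<in> borel_measurable borel" using f by auto
  have gauss: "integrable lborel (\<lambda>\<xi>. std_normal_density (\<xi> / a))"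
    using lborel_integrable_real_affine[OF integrable_std_normal_moment[of 0], of "1 / a" 0] a by simp
  have intF: "integrable (lborel \<Otimes>\<^sub>M lborel) (case_prod F)"
  proof (rule lborel_pair.Fubini_integrable)
    show "case_prod F \<in> borel_measurable (lborel \<Otimes>\<^sub>M lborel)"
      unfolding F_def by measurable
    have nrm: "norm (F x \<xi>) = norm (f x) * std_normal_density (\<xi> / a)" for x \<xi>
      by (simp add: F_def norm_mult normal_density_nonneg)
    show "integrable lborel (\<lambda>x. LINT \<xi>|lborel. norm (case_prod F (x, \<xi>)))"
      using f by (simp add: nrm)
    show "AE x in lborel. integrable lborel (\<lambda>\<xi>. case_prod F (x, \<xi>))"
    proof (rule AE_I2)
      fix x
      show "integrable lborel (\<lambda>\<xi>. case_prod F (x, \<xi>))"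
        by (rule Bochner_Integration.integrable_bound[OF integrable_mult_right[OF gauss, of "norm (f x)"]])
           (auto simp: nrm normal_density_nonneg, unfold F_def, measurable)
    qed
  qed
  have "(LINT \<xi>|lborel. fourier f \<xi> * iexp (2 * pi * \<xi> * (- y)) * of_real (sqrt (2 * pi) * std_normal_density (\<xi> / a)))
     = (LINT \<xi>|lborel. of_real (sqrt (2 * pi)) * (LINT x|lborel. F x \<xi>))"
  proof (rule Bochner_Integration.integral_cong[OF refl])
    fix \<xi>
    have "F x \<xi> = (f x * iexp (2 * pi * x * \<xi>)) * (iexp (2 * pi * \<xi> * (- y)) * of_real (std_normal_density (\<xi> / a)))" for x
      by (simp add: F_def exp_add[symmetric] algebra_simps exp_diff exp_minus field_simps)
    then have "(LINT x|lborel. F x \<xi>) = fourier f \<xi> * (iexp (2 * pi * \<xi> * (- y)) * of_real (std_normal_density (\<xi> / a)))"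
      by (simp add: fourier_iexp)
    then show "fourier f \<xi> * iexp (2 * pi * \<xi> * (- y)) * of_real (sqrt (2 * pi) * std_normal_density (\<xi> / a))
        = of_real (sqrt (2 * pi)) * (LINT x|lborel. F x \<xi>)" by simp
  qed
  also have "\<dots> = of_real (sqrt (2 * pi)) * (LINT x|lborel. LINT \<xi>|lborel. F x \<xi>)"
    by (simp add: lborel_pair.Fubini_integral[OF intF])
  also have "(\<lambda>x. LINT \<xi>|lborel. F x \<xi>)
      = (\<lambda>x. f x * of_real (a * sqrt (2 * pi) * std_normal_density (2 * pi * a * (x - y))))"
  proof
    fix x
    have "(LINT \<xi>|lborel. F x \<xi>) = f x * (LINT \<xi>|lborel. of_real (std_normal_density (\<xi> / a)) * iexp (2 * pi * (x - y) * \<xi>))"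
      by (simp add: F_def mult.assoc mult.commute[of "of_real (std_normal_density _)"])
    then show "(LINT \<xi>|lborel. F x \<xi>) = f x * of_real (a * sqrt (2 * pi) * std_normal_density (2 * pi * a * (x - y)))"
      unfolding LBINT_scaled_normal_iexp[OF a] by (simp add: mult_ac)
  qed
  also have "of_real (sqrt (2 * pi)) * (LINT x|lborel. f x * of_real (a * sqrt (2 * pi) * std_normal_density (2 * pi * a * (x - y))))
      = (LINT x|lborel. (2 * pi * a) *\<^sub>R (std_normal_density (2 * pi * a * (x - y)) *\<^sub>R f x))"
    unfolding integral_mult_right_zero[symmetric]
    by (rule Bochner_Integration.integral_cong[OF refl]) (simp add: scaleR_conv_of_real flip: of_real_mult)
  \<comment> \<open>Substitution \<open>x = y + v / (2 * pi * a)\<close>; the Jacobian cancels the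
    factor \<open>2 * pi * a\<close>.\<close>
  also have "\<dots> = (LINT v|lborel. std_normal_density v *\<^sub>R f (y + v / (2 * pi * a)))"
    using a lborel_integral_real_affine[of "1 / (2 * pi * a)" "\<lambda>x. (2 * pi * a) *\<^sub>R (std_normal_density (2 * pi * a * (x - y)) *\<^sub>R f x)" y]
    by (simp del: integral_scaleR_right add: integral_scaleR_right[symmetric])
  finally show ?thesis .
qed

text \<open>The width \<open>a = Suc n\<close> of the regularizing Gaussian tends to infinity. On
  the frequency side \<open>norm (fourier f)\<close> dominates; on the other side the averages of
  \<open>f\<close> concentrate at \<open>y\<close>, where continuity and boundedness of
  \<open>f\<close> give the limit.\<close>

theorem fourier_inversion:
  assumes f: "integrable lborel f" "continuous_on UNIV f" "bounded (range f)"
    and ff: "integrable lborel (fourier f)"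
  shows "fourier (fourier f) (- y) = f y"
proof (rule LIMSEQ_unique)
  let ?L = "\<lambda>n. LINT \<xi>|lborel. fourier f \<xi> * iexp (2 * pi * \<xi> * (- y)) * of_real (sqrt (2 * pi) * std_normal_density (\<xi> / Suc n))"
  have [measurable]: "f \<in> borel_measurable borel" "fourier f \<in> borel_measurable borel"
    using f(1) ff by auto
  have inv: "filterlim (\<lambda>n. inverse (real (Suc n))) (nhds 0) sequentially"
    by (rule LIMSEQ_inverse_real_of_nat)
  \<comment> \<open>The factor \<open>sqrt (2 * pi)\<close> normalizes the Gaussian to have maximum
    1, attained at 0, so the regularizer tends to 1 pointwise and never exceeds it.\<close>
  have normal_le: "sqrt (2 * pi) * std_normal_density u \<le> 1" for u
    by (simp add: std_normal_density_def)
  have cont_normal: "isCont std_normal_density u" for u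
    unfolding std_normal_density_def by (intro continuous_intros) auto
  show "?L \<longlonglongrightarrow> fourier (fourier f) (- y)"
    unfolding fourier_iexp[of "fourier f"]
  proof (rule integral_dominated_convergence[where w = "\<lambda>\<xi>. norm (fourier f \<xi>)"])
    show "AE \<xi> in lborel. (\<lambda>n. fourier f \<xi> * iexp (2 * pi * \<xi> * (- y)) * of_real (sqrt (2 * pi) * std_normal_density (\<xi> / Suc n)))
        \<longlonglongrightarrow> fourier f \<xi> * iexp (2 * pi * \<xi> * (- y))"
    proof (rule AE_I2)
      fix \<xi>
      have "(\<lambda>n. \<xi> / Suc n) \<longlonglongrightarrow> 0"
        using tendsto_mult_right_zero[OF inv, of \<xi>] by (simp add: divide_inverse)
      then have "(\<lambda>n. std_normal_density (\<xi> / Suc n)) \<longlonglongrightarrow> std_normal_density 0"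
        using isCont_tendsto_compose[OF cont_normal] by blast
      then have "(\<lambda>n. fourier f \<xi> * iexp (2 * pi * \<xi> * (- y)) * of_real (sqrt (2 * pi) * std_normal_density (\<xi> / Suc n)))
        \<longlonglongrightarrow> fourier f \<xi> * iexp (2 * pi * \<xi> * (- y)) * of_real (sqrt (2 * pi) * std_normal_density 0)"
        by (intro tendsto_intros)
      moreover have "sqrt (2 * pi) * std_normal_density 0 = 1"
        by (simp add: std_normal_density_def)
      ultimately show "(\<lambda>n. fourier f \<xi> * iexp (2 * pi * \<xi> * (- y)) * of_real (sqrt (2 * pi) * std_normal_density (\<xi> / Suc n)))
        \<longlonglongrightarrow> fourier f \<xi> * iexp (2 * pi * \<xi> * (- y))" by simp
    qed
    show "AE \<xi> in lborel. norm (fourier f \<xi> * iexp (2 * pi * \<xi> * (- y)) * of_real (sqrt (2 * pi) * std_normal_density (\<xi> / Suc n))) \<le> norm (fourier f \<xi>)" for n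
    proof (rule AE_I2)
      fix \<xi>
      have "norm (fourier f \<xi>) * (sqrt (2 * pi) * std_normal_density (\<xi> / Suc n)) \<le> norm (fourier f \<xi>) * 1"
        by (intro mult_left_mono normal_le norm_ge_zero)
      then show "norm (fourier f \<xi> * iexp (2 * pi * \<xi> * (- y)) * of_real (sqrt (2 * pi) * std_normal_density (\<xi> / Suc n))) \<le> norm (fourier f \<xi>)"
        by (simp only: norm_mult norm_of_real norm_exp_i_times) (simp add: normal_density_nonneg abs_mult)
    qed
  qed (use ff in auto)
  obtain C where C: "norm (f x) \<le> C" for x
    using f(3) by (auto simp: bounded_iff)
  have "(\<lambda>n. LINT v|lborel. std_normal_density v *\<^sub>R f (y + v / (2 * pi * Suc n))) \<longlonglongrightarrow> (LINT v|lborel. std_normal_density v *\<^sub>R f y)"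
  proof (rule integral_dominated_convergence[where w = "\<lambda>v. std_normal_density v * C"])
    show "AE v in lborel. (\<lambda>n. std_normal_density v *\<^sub>R f (y + v / (2 * pi * Suc n))) \<longlonglongrightarrow> std_normal_density v *\<^sub>R f y"
    proof (rule AE_I2)
      fix v
      have "(\<lambda>n. y + v / (2 * pi) * inverse (real (Suc n))) \<longlonglongrightarrow> y + v / (2 * pi) * 0"
        by (intro tendsto_intros inv)
      then have "(\<lambda>n. y + v / (2 * pi * Suc n)) \<longlonglongrightarrow> y"
        by (simp add: field_simps)
      then have "(\<lambda>n. f (y + v / (2 * pi * Suc n))) \<longlonglongrightarrow> f y"
        using f(2) isCont_tendsto_compose[of y f] by (auto simp: continuous_on_eq_continuous_at)
      then show "(\<lambda>n. std_normal_density v *\<^sub>R f (y + v / (2 * pi * Suc n))) \<longlonglongrightarrow> std_normal_density v *\<^sub>R f y"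
        by (intro tendsto_intros)
    qed
    show "integrable lborel (\<lambda>v. std_normal_density v * C)"
      using integrable_std_normal_moment[of 0] by simp
    show "AE v in lborel. norm (std_normal_density v *\<^sub>R f (y + v / (2 * pi * Suc n))) \<le> std_normal_density v * C" for n
      by (rule AE_I2) (auto intro!: mult_left_mono C simp: normal_density_nonneg)
  qed auto
  also have "(LINT v|lborel. std_normal_density v *\<^sub>R f y) = f y"
    using integral_std_normal_moment_even[of 0] integrable_std_normal_moment[of 0] by simp
  finally show "?L \<longlonglongrightarrow> f y"
    by (subst gaussian_regularized_inversion) (use f(1) in \<open>auto simp del: of_nat_Suc\<close>)
qed

section \<open>Schwartz functions\<close>

lemma integrable_inverse_one_plus_square: "integrable lborel (\<lambda>x::real. inverse (1 + x\<^sup>2))"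
  using integrable_inverse_1_plus_square by (simp add: einterval_eq_UNIV set_integrable_def)

lemma schwartz_bounded:
  assumes "f \<in> schwartz"
  obtains C where "\<And>x. norm (\<bar>x\<bar> ^ j *\<^sub>R nth_vderiv k f x) \<le> C"
proof -
  have "bounded (range (\<lambda>x. \<bar>x\<bar> ^ j *\<^sub>R nth_vderiv k f x))"
    using assms by (simp add: schwartz_def)
  then show ?thesis using that by (auto simp: bounded_iff)
qed

lemma nth_vderiv_has_vector_derivative:
  assumes "f \<in> schwartz"
  shows "(nth_vderiv k f has_vector_derivative nth_vderiv (Suc k) f x) (at x)"
  using assms vector_derivative_works by (auto simp: schwartz_def nth_vderiv_def)

lemma continuous_nth_vderiv: "f \<in> schwartz \<Longrightarrow> isCont (nth_vderiv k f) x"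
  using nth_vderiv_has_vector_derivative has_vector_derivative_continuous by blast

lemma nth_vderiv_measurable:
  assumes "f \<in> schwartz"
  shows "nth_vderiv k f \<in> borel_measurable borel"
  using continuous_nth_vderiv[OF assms] by (intro borel_measurable_continuous_onI continuous_at_imp_continuous_on) auto

text \<open>The bounds with exponents \<open>k\<close> and \<open>k + 2\<close> add up to one for
  the integrand times \<open>1 + x\<^sup>2\<close>, which yields an integrable majorant.\<close>

lemma finite_moments_of_decay:
  assumes meas: "h \<in> borel_measurable borel"
    and bound: "\<And>j. \<exists>C. \<forall>x. \<bar>x\<bar> ^ j * norm (h x) \<le> C"
  shows "finite_moments h"
  unfolding finite_moments_def
proof (intro conjI allI meas)
  fix k
  obtain C where C: "\<And>x. \<bar>x\<bar> ^ k * norm (h x) \<le> C" using bound[of k] by blast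
  obtain C' where C': "\<And>x. \<bar>x\<bar> ^ (k + 2) * norm (h x) \<le> C'" using bound[of "k + 2"] by blast
  show "integrable lborel (\<lambda>x. \<bar>x\<bar> ^ k * norm (h x))"
  proof (rule Bochner_Integration.integrable_bound)
    show "integrable lborel (\<lambda>x. (C + C') * inverse (1 + x\<^sup>2))"
      using integrable_inverse_one_plus_square by simp
    show "(\<lambda>x. \<bar>x\<bar> ^ k * norm (h x)) \<in> borel_measurable lborel"
      using meas by measurable
    show "AE x in lborel. norm (\<bar>x\<bar> ^ k * norm (h x)) \<le> norm ((C + C') * inverse (1 + x\<^sup>2))"
    proof (rule AE_I2)
      fix x
      have "(\<bar>x\<bar> ^ k * norm (h x)) * (1 + x\<^sup>2) \<le> C + C'"
        using add_mono[OF C[of x] C'[of x]]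
        by (simp add: algebra_simps power_add power2_eq_square flip: abs_mult)
      moreover have "0 < 1 + x\<^sup>2" by (simp add: add_pos_nonneg)
      ultimately have "\<bar>x\<bar> ^ k * norm (h x) \<le> (C + C') * inverse (1 + x\<^sup>2)"
        by (simp add: divide_inverse[symmetric] pos_le_divide_eq)
      also have "\<dots> \<le> norm ((C + C') * inverse (1 + x\<^sup>2))" by simp
      finally show "norm (\<bar>x\<bar> ^ k * norm (h x)) \<le> norm ((C + C') * inverse (1 + x\<^sup>2))" by simp
    qed
  qed
qed

lemma finite_moments_nth_vderiv:
  assumes "f \<in> schwartz"
  shows "finite_moments (nth_vderiv k f)"
proof (rule finite_moments_of_decay)
  show "\<exists>C. \<forall>x. \<bar>x\<bar> ^ j * norm (nth_vderiv k f x) \<le> C" for j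
    by (rule schwartz_bounded[OF assms, of j k]) (auto simp: power_abs)
qed (use assms nth_vderiv_measurable in auto)

lemma decay_imp_tendsto_0:
  fixes h :: "real \<Rightarrow> complex"
  assumes "\<And>x. \<bar>x\<bar> * norm (h x) \<le> C"
  shows "(h \<longlongrightarrow> 0) at_infinity"
proof (rule Lim_null_comparison)
  show "\<forall>\<^sub>F x in at_infinity. norm (h x) \<le> C * inverse (norm x)"
    unfolding eventually_at_infinity
    using assms by (intro exI[of _ 1]) (auto simp: field_simps)
  show "((\<lambda>x::real. C * inverse (norm x)) \<longlongrightarrow> 0) at_infinity"
    by (intro tendsto_mult_right_zero tendsto_inverse_0_at_top filterlim_norm_at_top)
qed

section \<open>The transform of a derivative and the decay it implies\<close>

lemma LBINT_derivative_eq_0: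
  fixes F :: "real \<Rightarrow> complex"
  assumes deriv: "\<And>x. (F has_vector_derivative F' x) (at x)"
    and "\<And>x. isCont F' x" "integrable lborel F'" and lim: "(F \<longlongrightarrow> 0) at_infinity"
  shows "(LINT x|lborel. F' x) = 0"
proof -
  have "(LBINT x=-\<infinity>..\<infinity>. F' x) = 0 - 0"
  proof (rule interval_integral_FTC_integrable)
    show "((F \<circ> real_of_ereal) \<longlongrightarrow> 0) (at_right (-\<infinity>))"
      unfolding ereal_tendsto_simps
      using lim at_bot_le_at_infinity tendsto_mono by blast
    show "((F \<circ> real_of_ereal) \<longlongrightarrow> 0) (at_left \<infinity>)"
      unfolding ereal_tendsto_simps
      using lim at_top_le_at_infinity tendsto_mono by blast
    show "set_integrable lborel (einterval (-\<infinity>) \<infinity>) F'"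
      using assms by (simp add: einterval_eq_UNIV set_integrable_def)
  qed (use assms in auto)
  then show ?thesis
    by (simp add: interval_lebesgue_integral_def einterval_eq_UNIV set_lebesgue_integral_def)
qed

text \<open>Integration by parts: the derivative of \<open>h x * iexp (2 * pi * x * \<xi>)\<close>
  has integral 0. The minus sign comes from the plus sign in the exponent of the kernel.\<close>

lemma fourier_derivative:
  assumes deriv: "\<And>x. (h has_vector_derivative h' x) (at x)"
    and cont: "\<And>x. isCont h' x" and int: "integrable lborel h" "integrable lborel h'"
    and lim: "(h \<longlongrightarrow> 0) at_infinity"
  shows "fourier h' \<xi> = - (2 * pi * \<i> * \<xi>) * fourier h \<xi>"
proof -
  let ?e = "\<lambda>x. iexp (2 * pi * x * \<xi>)"
  let ?F' = "\<lambda>x. h' x * ?e x + (2 * pi * \<i> * \<xi>) * (h x * ?e x)"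
  have hcont: "isCont h x" for x using deriv has_vector_derivative_continuous by blast
  have "(LINT x|lborel. ?F' x) = 0"
  proof (rule LBINT_derivative_eq_0[where F = "\<lambda>x. h x * ?e x"])
    fix x
    have "((\<lambda>x. ?e x) has_vector_derivative (2 * pi * \<i> * \<xi>) * ?e x) (at x)"
    proof -
      have "((iexp \<circ> (\<lambda>x. 2 * pi * x * \<xi>)) has_vector_derivative (2 * pi * \<xi>) *\<^sub>R (\<i> * ?e x)) (at x)"
        by (rule vector_diff_chain_at) (auto intro!: derivative_eq_intros simp: has_real_derivative_iff_has_vector_derivative[symmetric])
      then show ?thesis by (simp add: o_def scaleR_conv_of_real mult_ac)
    qed
    from has_vector_derivative_mult[OF deriv[of x] this]
    show "((\<lambda>x. h x * ?e x) has_vector_derivative ?F' x) (at x)"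
      by (simp add: mult_ac add.commute)
    show "isCont ?F' x"
      by (intro continuous_intros cont hcont)
  next
    show "integrable lborel ?F'"
      using integrable_mult_iexp[OF int(1), of "2 * pi" \<xi>] integrable_mult_iexp[OF int(2), of "2 * pi" \<xi>] by simp
    show "((\<lambda>x. h x * ?e x) \<longlongrightarrow> 0) at_infinity"
      by (rule tendsto_norm_zero_cancel) (use tendsto_norm_zero[OF lim] in \<open>simp add: norm_mult\<close>)
  qed
  then show ?thesis
    unfolding fourier_iexp
    using integrable_mult_iexp[OF int(1), of "2 * pi" \<xi>] integrable_mult_iexp[OF int(2), of "2 * pi" \<xi>]
    by (simp add: add_eq_0_iff)
qed

lemma fourier_nth_vderiv:
  assumes f: "f \<in> schwartz"
  shows "fourier (nth_vderiv k f) \<xi> = (- (2 * pi * \<i> * \<xi>)) ^ k * fourier f \<xi>"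
proof (induction k)
  case (Suc k)
  obtain C where C: "\<And>x. norm (\<bar>x\<bar> ^ 1 *\<^sub>R nth_vderiv k f x) \<le> C"
    using schwartz_bounded[OF f] by blast
  have "fourier (nth_vderiv (Suc k) f) \<xi> = - (2 * pi * \<i> * \<xi>) * fourier (nth_vderiv k f) \<xi>"
  proof (rule fourier_derivative)
    show "(nth_vderiv k f \<longlongrightarrow> 0) at_infinity"
      by (rule decay_imp_tendsto_0[of _ C]) (use C in simp)
  qed (use f nth_vderiv_has_vector_derivative continuous_nth_vderiv finite_moments_nth_vderiv
      finite_moments_imp_integrable in auto)
  then show ?case by (simp add: Suc)
qed (simp add: nth_vderiv_def)

lemma finite_moments_schwartz: "f \<in> schwartz \<Longrightarrow> finite_moments f"
  using finite_moments_nth_vderiv[of f 0] by (simp add: nth_vderiv_def)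

text \<open>Powers of \<open>x\<close> are traded for derivatives of \<open>f\<close>: up to a
  factor of modulus at least 1, \<open>x ^ j * fourier f x\<close> is the transform of the
  integrable function \<open>nth_vderiv j f\<close>, hence bounded.\<close>

lemma finite_moments_fourier_schwartz:
  assumes f: "f \<in> schwartz"
  shows "finite_moments (fourier f)"
proof (rule finite_moments_of_decay)
  show "fourier f \<in> borel_measurable borel"
    by (intro finite_moments_fourier_measurable finite_moments_schwartz f)
  fix j
  have "\<bar>x\<bar> ^ j * norm (fourier f x) \<le> (LINT t|lborel. norm (nth_vderiv j f t))" for x
  proof -
    have "\<bar>x\<bar> ^ j * norm (fourier f x) \<le> (2 * pi) ^ j * (\<bar>x\<bar> ^ j * norm (fourier f x))"
      using pi_gt3 mult_right_mono[OF one_le_power[of "2 * pi" j], of "\<bar>x\<bar> ^ j * norm (fourier f x)"] by simp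
    also have "\<dots> = norm (fourier (nth_vderiv j f) x)"
      by (simp add: fourier_nth_vderiv[OF f] norm_mult norm_power power_mult_distrib)
    also have "\<dots> \<le> (LINT t|lborel. norm (nth_vderiv j f t))"
      by (intro norm_fourier_le finite_moments_imp_integrable finite_moments_nth_vderiv f)
    finally show ?thesis .
  qed
  then show "\<exists>C. \<forall>x. \<bar>x\<bar> ^ j * norm (fourier f x) \<le> C" by blast
qed

text \<open>Lets \<open>f\<close> and \<open>fourier f\<close> exchange roles. The reflection is
  harmless, since absolute moments and a zero set symmetric about 0 are invariant under it.\<close>

lemma fourier_fourier_schwartz:
  assumes f: "f \<in> schwartz"
  shows "fourier (fourier f) x = f (- x)"
proof -
  obtain C where C: "norm (f y) \<le> C" for y
    using schwartz_bounded[OF f, of 0 0] by (auto simp: nth_vderiv_def)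
  have "fourier (fourier f) (- (- x)) = f (- x)"
  proof (rule fourier_inversion)
    show "integrable lborel f" "integrable lborel (fourier f)"
      using f by (simp_all add: finite_moments_imp_integrable finite_moments_schwartz finite_moments_fourier_schwartz)
    show "continuous_on UNIV f"
      using continuous_nth_vderiv[OF f, where k = 0] by (simp add: nth_vderiv_def continuous_at_imp_continuous_on)
    show "bounded (range f)" using C by (auto simp: bounded_iff)
  qed
  then show ?thesis by simp
qed

section \<open>Functions vanishing at powers of integers\<close>

text \<open>The \<open>k\<close>-th derivative of \<open>fourier h\<close> is the transform of
  \<open>(2 * pi * \<i> * t) ^ k * h t\<close>, so it is bounded by the integral of the norm of that
  function, which is \<open>(2 * pi) ^ k * moment k h\<close>.\<close>

lemma fourier_le_of_zeros:
  assumes h: "finite_moments h"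
    and Z: "finite Z" "card Z = k" "\<And>z. z \<in> Z \<Longrightarrow> fourier h z = 0"
  shows "norm (fourier h x) \<le> 2 * (\<Prod>z\<in>Z. \<bar>x - z\<bar>) / fact k * ((2 * pi) ^ k * moment k h)"
proof -
  have "norm (fourier (\<lambda>t. (2 * pi * \<i> * t) ^ k * h t) y) \<le> (2 * pi) ^ k * moment k h" for y
  proof -
    have "integrable lborel (\<lambda>t. (2 * pi * \<i>) ^ k * ((1 * t) ^ k * h t))"
      using finite_moments_integrable[OF h, of 1 k] by (intro integrable_mult_right) simp
    then have "integrable lborel (\<lambda>t. (2 * pi * \<i> * t) ^ k * h t)"
      by (simp add: power_mult_distrib mult.assoc)
    from norm_fourier_le[OF this, of y] show ?thesis
      by (simp add: moment_def norm_mult norm_power power_mult_distrib mult.assoc)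
  qed
  from complex_interpolation_error[where g = "\<lambda>i. fourier (\<lambda>t. (2 * pi * \<i> * t) ^ i * h t)",
      OF finite_moments_higher_derivative[OF h] Z(1,2) _ this]
  show ?thesis using Z(3) by simp
qed

section \<open>Nodes among the powers and the decay they force\<close>

lemma powr_add_le_of_concave:
  fixes \<alpha> a t :: real
  assumes "0 < \<alpha>" "\<alpha> \<le> 1" "0 < a" "0 \<le> t"
  shows "(a + t) powr \<alpha> - a powr \<alpha> \<le> t * \<alpha> * a powr (\<alpha> - 1)"
proof (cases "t = 0")
  case False
  then have "a < a + t" using assms by simp
  have "((\<lambda>x. x powr \<alpha>) has_real_derivative \<alpha> * y powr (\<alpha> - 1)) (at y)" if "a \<le> y" for y
    using that assms by (intro has_real_derivative_powr) simp
  with \<open>a < a + t\<close> obtain z where z: "a < z" "(a + t) powr \<alpha> - a powr \<alpha> = (a + t - a) * (\<alpha> * z powr (\<alpha> - 1))"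
    using MVT2[of a "a + t" "\<lambda>x. x powr \<alpha>" "\<lambda>x. \<alpha> * x powr (\<alpha> - 1)"] by blast
  have "z powr (\<alpha> - 1) \<le> a powr (\<alpha> - 1)"
    using assms z by (intro powr_mono2') auto
  then have "t * \<alpha> * z powr (\<alpha> - 1) \<le> t * \<alpha> * a powr (\<alpha> - 1)"
    using assms by (intro mult_left_mono) auto
  then show ?thesis using z by simp
qed simp

text \<open>The nodes are the powers \<open>(N + i) powr \<alpha>\<close>, \<open>1 \<le> i \<le> k\<close>, just beyond \<open>x\<close>: consecutive ones
  are at most \<open>x powr (1 - 1 / \<alpha>) \<le> 1 / x\<^sup>2\<close> apart, so that the product of the
  distances carries a factor \<open>fact k\<close>, which cancels the one in the interpolation error.\<close>

lemma exists_close_powers: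
  fixes \<alpha> x :: real
  assumes \<alpha>: "0 < \<alpha>" "\<alpha> \<le> 1 / 3" and x: "1 \<le> x"
  shows "\<exists>Z. finite Z \<and> card Z = k \<and> Z \<subseteq> range (\<lambda>n::nat. real n powr \<alpha>) \<and>
    (\<Prod>z\<in>Z. \<bar>x - z\<bar>) * x ^ (2 * k) \<le> fact k"
proof -
  \<comment> \<open>The index for which \<open>x\<close> lies between \<open>N powr \<alpha>\<close>
    and \<open>(N + 1) powr \<alpha>\<close>; \<open>1 \<le> x\<close> makes it at least 1.\<close>
  define N where "N = nat \<lfloor>x powr (1 / \<alpha>)\<rfloor>"
  have "1 \<le> x powr (1 / \<alpha>)" using x \<alpha> by (intro ge_one_powr_ge_zero) auto
  then have N: "1 \<le> N" "real N \<le> x powr (1 / \<alpha>)" "x powr (1 / \<alpha>) \<le> real N + 1"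
    unfolding N_def by linarith+
  have x_eq: "(x powr (1 / \<alpha>)) powr \<alpha> = x" using x \<alpha> by (simp add: powr_powr)
  have lower: "real N powr \<alpha> \<le> x"
    using powr_mono2[of \<alpha> "real N", OF _ _ N(2)] \<alpha> by (simp add: x_eq)
  have upper: "x \<le> (real N + 1) powr \<alpha>"
    using powr_mono2[of \<alpha> _ _, OF _ _ N(3)] \<alpha> by (simp add: x_eq)
  define w where "w i = real (N + i) powr \<alpha>" for i
  have inj: "inj_on w {1..k}"
  proof (rule inj_onI)
    fix i j assume "w i = w j"
    then have "(w i) powr (1 / \<alpha>) = (w j) powr (1 / \<alpha>)" by simp
    then show "i = j" using \<alpha> by (simp add: w_def powr_powr)
  qed
  \<comment> \<open>The slope of \<open>u powr \<alpha>\<close> at \<open>N\<close> controls the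
    gaps beyond. By \<open>x \<le> (2 * N) powr \<alpha>\<close> the left side is at most
    \<open>\<alpha> * 2 powr (2 * \<alpha>) * N powr (3 * \<alpha> - 1)\<close>; with
    \<open>\<alpha> \<le> 1 / 3\<close> the last exponent is nonpositive and the constant at most 2
    / 3.\<close>
  have "\<alpha> * real N powr (\<alpha> - 1) * x\<^sup>2 \<le> 1"
  proof -
    have "x\<^sup>2 \<le> ((2 * real N) powr \<alpha>)\<^sup>2"
      using N x \<alpha> by (intro power_mono order_trans[OF upper] powr_mono2) auto
    also have "\<dots> = (2 * real N) powr (2 * \<alpha>)"
      using N by (simp add: powr_power)
    also have "\<dots> = 2 powr (2 * \<alpha>) * real N powr (2 * \<alpha>)" by (simp add: powr_mult)
    finally have "\<alpha> * real N powr (\<alpha> - 1) * x\<^sup>2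
        \<le> \<alpha> * real N powr (\<alpha> - 1) * (2 powr (2 * \<alpha>) * real N powr (2 * \<alpha>))"
      using \<alpha> by (intro mult_left_mono) auto
    also have "\<dots> = \<alpha> * 2 powr (2 * \<alpha>) * real N powr (3 * \<alpha> - 1)"
      by (simp add: powr_add[symmetric] algebra_simps)
    also have "\<dots> \<le> (1 / 3 * 2 powr 1) * 1"
      using \<alpha> N powr_mono[of "3 * \<alpha> - 1" 0 "real N"]
      by (intro mult_mono powr_mono) auto
    finally show ?thesis by simp
  qed
  then have step: "\<alpha> * real N powr (\<alpha> - 1) \<le> 1 / x\<^sup>2" using x by (simp add: field_simps)
  have dist: "\<bar>x - w i\<bar> \<le> real i * (1 / x\<^sup>2)" if "1 \<le> i" for i
  proof -
    \<comment> \<open>Since \<open>x\<close> lies between \<open>N powr \<alpha>\<close> and the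
      node, its distance to the node is at most that of \<open>N powr \<alpha>\<close>, which
      concavity bounds.\<close>
    have "x \<le> w i"
      unfolding w_def using \<alpha> that by (intro order_trans[OF upper] powr_mono2) auto
    then have "\<bar>x - w i\<bar> \<le> (real N + real i) powr \<alpha> - real N powr \<alpha>"
      using lower by (simp add: w_def)
    also have "\<dots> \<le> real i * (\<alpha> * real N powr (\<alpha> - 1))"
      using powr_add_le_of_concave[of \<alpha> "real N" "real i"] \<alpha> N by (simp add: mult.assoc)
    also have "\<dots> \<le> real i * (1 / x\<^sup>2)"
      by (intro mult_left_mono step) simp
    finally show ?thesis .
  qed
  have "(\<Prod>z\<in>w ` {1..k}. \<bar>x - z\<bar>) = (\<Prod>i\<in>{1..k}. \<bar>x - w i\<bar>)"
    by (simp only: prod.reindex[OF inj] o_def)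
  also have "\<dots> \<le> (\<Prod>i\<in>{1..k}. real i * (1 / x\<^sup>2))"
    using dist by (intro prod_mono) simp
  also have "\<dots> = fact k / x ^ (2 * k)"
    by (simp add: prod_dividef fact_prod power_mult)
  finally have "(\<Prod>z\<in>w ` {1..k}. \<bar>x - z\<bar>) * x ^ (2 * k) \<le> fact k"
    using x by (simp add: field_simps)
  moreover have "card (w ` {1..k}) = k" by (simp only: card_image[OF inj] card_atLeastAtMost diff_Suc_1)
  moreover have "w ` {1..k} \<subseteq> range (\<lambda>n::nat. real n powr \<alpha>)"
    unfolding w_def by blast
  ultimately show ?thesis
    by (intro exI[of _ "w ` {1..k}"] conjI finite_imageI finite_atLeastAtMost)
qed

text \<open>For negative \<open>x\<close> the nodes close to \<open>\<bar>x\<bar>\<close> are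
  reflected, which uses the zeros of the other sign and keeps the product of distances. Its bound
  \<open>fact k / \<bar>x\<bar> ^ (2 * k)\<close> cancels the factorial in the interpolation
  error.\<close>

lemma fourier_decay_of_power_zeros:
  fixes \<alpha> x :: real
  assumes \<alpha>: "0 < \<alpha>" "\<alpha> \<le> 1 / 3" and h: "finite_moments h"
    and zeros: "\<And>n::nat. fourier h (real n powr \<alpha>) = 0 \<and> fourier h (- (real n powr \<alpha>)) = 0"
    and x: "1 \<le> \<bar>x\<bar>"
  shows "norm (fourier h x) * \<bar>x\<bar> ^ (2 * k) \<le> 2 * ((2 * pi) ^ k * moment k h)"
proof -
  obtain Z where Z: "finite Z" "card Z = k" "Z \<subseteq> range (\<lambda>n::nat. real n powr \<alpha>)"
      "(\<Prod>z\<in>Z. \<bar>\<bar>x\<bar> - z\<bar>) * \<bar>x\<bar> ^ (2 * k) \<le> fact k"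
    using exists_close_powers[OF \<alpha> x, of k] by blast
  define W where "W = (\<lambda>z. sgn x * z) ` Z"
  have inj: "inj_on (\<lambda>z. sgn x * z) Z" using x by (auto simp: inj_on_def sgn_if)
  have "fourier h z = 0" if "z \<in> W" for z
    using that Z(3) zeros x by (auto simp: W_def sgn_if split: if_splits)
  then have "norm (fourier h x) \<le> 2 * (\<Prod>z\<in>W. \<bar>x - z\<bar>) / fact k * ((2 * pi) ^ k * moment k h)"
    using Z by (intro fourier_le_of_zeros[OF h]) (auto simp: W_def card_image[OF inj])
  also have "(\<Prod>z\<in>W. \<bar>x - z\<bar>) = (\<Prod>z\<in>Z. \<bar>\<bar>x\<bar> - z\<bar>)"
    unfolding W_def prod.reindex[OF inj] o_def using x by (auto simp: sgn_if intro!: prod.cong)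
  finally have "norm (fourier h x) * \<bar>x\<bar> ^ (2 * k)
      \<le> 2 * (\<Prod>z\<in>Z. \<bar>\<bar>x\<bar> - z\<bar>) / fact k * ((2 * pi) ^ k * moment k h) * \<bar>x\<bar> ^ (2 * k)"
    by (intro mult_right_mono) auto
  also have "\<dots> = 2 * ((2 * pi) ^ k * moment k h) / fact k * ((\<Prod>z\<in>Z. \<bar>\<bar>x\<bar> - z\<bar>) * \<bar>x\<bar> ^ (2 * k))"
    by simp
  also have "\<dots> \<le> 2 * ((2 * pi) ^ k * moment k h) / fact k * fact k"
    by (intro mult_left_mono Z) (simp add: moment_nonneg)
  finally show ?thesis by simp
qed

section \<open>Growth of the moments\<close>

text \<open>For \<open>\<bar>x\<bar> < 1\<close> the integrand is at most that of the zeroth moment.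
  Elsewhere the decay of order \<open>2 * k\<close> applies, and two of its powers pay for the
  integrable weight \<open>inverse (1 + x\<^sup>2)\<close>; hence the gap of 2 between
  \<open>j\<close> and \<open>2 * k\<close>.\<close>

lemma moment_fourier_le_of_power_zeros:
  fixes \<alpha> :: real
  assumes \<alpha>: "0 < \<alpha>" "\<alpha> \<le> 1 / 3" and h: "finite_moments h" "finite_moments (fourier h)"
    and zeros: "\<And>n::nat. fourier h (real n powr \<alpha>) = 0 \<and> fourier h (- (real n powr \<alpha>)) = 0"
    and jk: "j + 2 \<le> 2 * k"
  shows "moment j (fourier h)
    \<le> moment 0 (fourier h) + 4 * (LINT x|lborel. inverse (1 + x\<^sup>2)) * (2 * pi) ^ k * moment k h"
proof -
  \<comment> \<open>One factor 2 is that of the decay bound, the other comes from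
    \<open>1 + x\<^sup>2 \<le> 2 * x\<^sup>2\<close> for
    \<open>1 \<le> \<bar>x\<bar>\<close>.\<close>
  define c where "c = 4 * ((2 * pi) ^ k * moment k h)"
  have c: "0 \<le> c" by (simp add: c_def moment_nonneg)
  have int: "integrable lborel (\<lambda>x. \<bar>x\<bar> ^ j * norm (fourier h x))" for j
    using h(2) by (simp add: finite_moments_def)
  have "moment j (fourier h) \<le> (LINT x|lborel. \<bar>x\<bar> ^ 0 * norm (fourier h x) + c * inverse (1 + x\<^sup>2))"
    unfolding moment_def
  proof (rule integral_mono[OF int])
    show "integrable lborel (\<lambda>x. \<bar>x\<bar> ^ 0 * norm (fourier h x) + c * inverse (1 + x\<^sup>2))"
      by (intro Bochner_Integration.integrable_add int integrable_mult_right integrable_inverse_one_plus_square)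
    fix x :: real
    have pos: "0 < 1 + x\<^sup>2" by (simp add: add_pos_nonneg)
    show "\<bar>x\<bar> ^ j * norm (fourier h x) \<le> \<bar>x\<bar> ^ 0 * norm (fourier h x) + c * inverse (1 + x\<^sup>2)"
    proof (cases "1 \<le> \<bar>x\<bar>")
      case True
      have "1 \<le> x\<^sup>2" using power_mono[OF True, of 2] by simp
      have "\<bar>x\<bar> ^ j * norm (fourier h x) * (1 + x\<^sup>2) \<le> \<bar>x\<bar> ^ j * norm (fourier h x) * (2 * x\<^sup>2)"
        using \<open>1 \<le> x\<^sup>2\<close> by (intro mult_left_mono) auto
      also have "\<dots> = 2 * (norm (fourier h x) * \<bar>x\<bar> ^ (j + 2))"
        by (simp add: power_add power2_eq_square)
      also have "\<dots> \<le> 2 * (norm (fourier h x) * \<bar>x\<bar> ^ (2 * k))"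
        using True jk by (intro mult_left_mono power_increasing) auto
      also have "\<dots> \<le> c"
        using fourier_decay_of_power_zeros[OF \<alpha> h(1) zeros True, of k]
        unfolding c_def by linarith
      finally have "\<bar>x\<bar> ^ j * norm (fourier h x) \<le> c * inverse (1 + x\<^sup>2)"
        using pos by (simp add: divide_inverse[symmetric] pos_le_divide_eq)
      then show ?thesis by (simp add: add_increasing)
    next
      case False
      then have "\<bar>x\<bar> ^ j * norm (fourier h x) \<le> 1 * norm (fourier h x)"
        by (intro mult_right_mono power_le_one) auto
      moreover have "0 \<le> c * inverse (1 + x\<^sup>2)" using c pos by simp
      ultimately show ?thesis by simp
    qed
  qed
  also have "\<dots> = moment 0 (fourier h) + c * (LINT x|lborel. inverse (1 + x\<^sup>2))"
    unfolding moment_def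
    by (subst Bochner_Integration.integral_add[OF int integrable_mult_right[OF integrable_inverse_one_plus_square]]) simp
  finally show ?thesis by (simp add: c_def mult_ac)
qed

text \<open>With \<open>k\<close> about \<open>j / 2\<close> the recursion halves the index, and the exponents \<open>k\<close> accumulated on the
  way down sum to \<open>O(j)\<close>.\<close>

lemma exponential_growth_of_halving_recursion:
  fixes S :: "nat \<Rightarrow> real"
  assumes S: "\<And>j. 0 \<le> S j" and ABC: "0 \<le> A" "0 \<le> B" "0 \<le> C"
    and rec: "\<And>j k. j + 2 \<le> 2 * k \<Longrightarrow> S j \<le> A + B * C ^ k * S k"
  shows "\<exists>D\<ge>1. \<forall>j. S j \<le> D ^ (2 * j + 1)"
proof -
  \<comment> \<open>One constant absorbs the constants of the recursion and the initial values that
    start the induction.\<close>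
  define D where "D = 1 + A + B + C + sum S {..<14}"
  have "0 \<le> sum S {..<14}" by (simp add: S sum_nonneg)
  with ABC have D: "1 \<le> D" "A + B \<le> D" "C \<le> D" by (auto simp: D_def)
  have "S j \<le> D ^ (2 * j + 1)" for j
  proof (induction j rule: less_induct)
    case (less j)
    show ?case
    proof (cases "j < 14")
      case True
      have "S j \<le> sum S {..<14}" using True by (intro member_le_sum) (auto simp: S)
      also have "\<dots> \<le> D" using ABC by (simp add: D_def)
      also have "\<dots> \<le> D ^ (2 * j + 1)" using D by (intro self_le_power) auto
      finally show ?thesis .
    next
      case False
      \<comment> \<open>Adding 2 instead of 1 covers odd \<open>j\<close>. The induction needs
        \<open>3 * k + 2 \<le> 2 * j + 1\<close>, which follows from
        \<open>3 * j / 2 + 8 \<le> 2 * j + 1\<close>, that is \<open>14 \<le> j\<close>.\<close>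
      define k where "k = j div 2 + 2"
      have k: "j + 2 \<le> 2 * k" "k < j" "k + (2 * k + 1) + 1 \<le> 2 * j + 1"
        using False by (auto simp: k_def)
      have "S j \<le> A + B * C ^ k * S k" by (rule rec[OF k(1)])
      also have "\<dots> \<le> A * (D ^ k * D ^ (2 * k + 1)) + B * (D ^ k * D ^ (2 * k + 1))"
      proof (rule add_mono)
        have "1 \<le> D ^ k * D ^ (2 * k + 1)" using D by (simp only: power_add[symmetric] one_le_power)
        then show "A \<le> A * (D ^ k * D ^ (2 * k + 1))"
          using mult_left_mono[of 1 "D ^ k * D ^ (2 * k + 1)" A] ABC(1) by (simp only: mult_1_right)
        have "C ^ k * S k \<le> D ^ k * D ^ (2 * k + 1)"
          using ABC D S less[OF k(2)] by (intro mult_mono power_mono) auto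
        then show "B * C ^ k * S k \<le> B * (D ^ k * D ^ (2 * k + 1))"
          using ABC by (simp only: mult.assoc mult_left_mono)
      qed
      also have "\<dots> = (A + B) * D ^ (k + (2 * k + 1))" by (simp only: power_add distrib_right)
      also have "\<dots> \<le> D * D ^ (k + (2 * k + 1))" using D by (intro mult_right_mono) auto
      also have "\<dots> = D ^ (k + (2 * k + 1) + 1)" by simp
      also have "\<dots> \<le> D ^ (2 * j + 1)" by (intro power_increasing k D)
      finally show ?thesis .
    qed
  qed
  with D show ?thesis by blast
qed

section \<open>Vanishing from exponential moments\<close>

text \<open>The limit in \<open>k\<close> is taken twice. Exponential moments first turn the decay
  bound into a geometric sequence of ratio \<open>q / y\<^sup>2\<close>, forcing zeros for large
  \<open>\<bar>y\<bar>\<close>. Then arbitrarily many nodes fit into one fixed interval, and the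
  factorial in the interpolation error beats the exponential growth.\<close>

lemma fourier_eq_0_of_exponential_moments:
  fixes \<alpha> :: real
  assumes \<alpha>: "0 < \<alpha>" "\<alpha> \<le> 1 / 3" and h: "finite_moments h"
    and zeros: "\<And>n::nat. fourier h (real n powr \<alpha>) = 0 \<and> fourier h (- (real n powr \<alpha>)) = 0"
    and D: "1 \<le> D" "\<And>k. moment k h \<le> D ^ (2 * k + 1)"
  shows "fourier h x = 0"
proof -
  define q where "q = 2 * pi * D\<^sup>2"
  have q: "0 \<le> q" by (simp add: q_def)
  have growth: "(2 * pi) ^ k * moment k h \<le> D * q ^ k" for k
  proof -
    have "(2 * pi) ^ k * moment k h \<le> (2 * pi) ^ k * D ^ (2 * k + 1)"
      by (intro mult_left_mono D) simp
    also have "\<dots> = D * q ^ k"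
      by (simp add: q_def power_mult_distrib power_mult)
    finally show ?thesis .
  qed
  \<comment> \<open>From this radius on, both \<open>1 \<le> \<bar>y\<bar>\<close>, required by the
    decay bound, and \<open>q < y\<^sup>2\<close> hold.\<close>
  define R where "R = 1 + q"
  have support: "fourier h y = 0" if y: "R \<le> \<bar>y\<bar>" for y
  proof -
    have y1: "1 \<le> \<bar>y\<bar>" and qy: "q < y\<^sup>2"
    proof -
      show "1 \<le> \<bar>y\<bar>" using y q by (simp add: R_def)
      then have "\<bar>y\<bar> * 1 \<le> \<bar>y\<bar> * \<bar>y\<bar>" by (intro mult_left_mono) auto
      then show "q < y\<^sup>2" using y by (simp add: R_def power2_eq_square)
    qed
    have bound: "norm (fourier h y) \<le> 2 * D * (q / y\<^sup>2) ^ k" for k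
    proof -
      have "norm (fourier h y) * (y\<^sup>2) ^ k \<le> 2 * (D * q ^ k)"
        using fourier_decay_of_power_zeros[OF \<alpha> h zeros y1, of k] growth[of k] by (simp add: power_mult)
      moreover have "0 < (y\<^sup>2) ^ k" using y1 by auto
      ultimately show ?thesis by (simp add: power_divide pos_le_divide_eq mult.assoc)
    qed
    have "(\<lambda>k. 2 * D * (q / y\<^sup>2) ^ k) \<longlonglongrightarrow> 0"
    proof (intro tendsto_mult_right_zero LIMSEQ_power_zero)
      have "0 < y\<^sup>2" using q qy by linarith
      then show "norm (q / y\<^sup>2) < 1" using q qy by simp
    qed
    then have "norm (fourier h y) \<le> 0"
      by (rule LIMSEQ_le_const) (use bound in auto)
    then show ?thesis by simp
  qed
  \<comment> \<open>Bounds the distance from \<open>x\<close> to every point of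
    \<open>{R..R + 1}\<close>, the interval that supplies the nodes.\<close>
  define L where "L = \<bar>x\<bar> + R + 1"
  have bound: "norm (fourier h x) \<le> 2 * D * (inverse (fact k) * (L * q) ^ k)" for k
  proof -
    have "infinite {R..R + 1}" by (simp add: infinite_Icc)
    then obtain Z where Z: "finite Z" "card Z = k" "Z \<subseteq> {R..R + 1}"
      using infinite_arbitrarily_large by metis
    have "0 \<le> R" using q by (simp add: R_def)
    then have zero: "fourier h z = 0" if "z \<in> Z" for z
      using that Z by (intro support) auto
    have "(\<Prod>z\<in>Z. \<bar>x - z\<bar>) \<le> (\<Prod>z\<in>Z. L)"
    proof (intro prod_mono conjI)
      fix z assume "z \<in> Z"
      then have "R \<le> z" "z \<le> R + 1" using Z by auto
      then show "\<bar>x - z\<bar> \<le> L" using \<open>0 \<le> R\<close> by (simp add: L_def abs_if)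
    qed auto
    then have prod: "(\<Prod>z\<in>Z. \<bar>x - z\<bar>) \<le> L ^ k" using Z by simp
    have "norm (fourier h x) \<le> 2 * (\<Prod>z\<in>Z. \<bar>x - z\<bar>) / fact k * ((2 * pi) ^ k * moment k h)"
      by (intro fourier_le_of_zeros[OF h] Z zero)
    also have "\<dots> \<le> 2 * L ^ k / fact k * (D * q ^ k)"
    proof (rule mult_mono)
      show "2 * (\<Prod>z\<in>Z. \<bar>x - z\<bar>) / fact k \<le> 2 * L ^ k / fact k"
        using prod by (simp add: divide_right_mono)
      show "0 \<le> 2 * L ^ k / fact k" using q by (simp add: L_def R_def)
    qed (rule growth, simp add: moment_nonneg)
    finally show ?thesis by (simp add: power_mult_distrib field_simps)
  qed
  have "(\<lambda>k. 2 * D * (inverse (fact k) * (L * q) ^ k)) \<longlonglongrightarrow> 0"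
    by (intro tendsto_mult_right_zero summable_LIMSEQ_zero summable_exp)
  then have "norm (fourier h x) \<le> 0"
    by (rule LIMSEQ_le_const) (use bound in auto)
  then show ?thesis by simp
qed

lemma integrable_reflect_iff:
  fixes g :: "real \<Rightarrow> real"
  shows "integrable lborel (\<lambda>x. g (- x)) \<longleftrightarrow> integrable lborel g"
  using lborel_integrable_real_affine_iff[of "-1" g 0] by simp

theorem corollary2:
  fixes \<alpha> :: real and f :: "real \<Rightarrow> complex"
  assumes "0 < \<alpha>" and "\<alpha> < 1 - sqrt 2 / 2"
    and "f \<in> schwartz"
    and "\<And>n::nat. f (real n powr \<alpha>) = 0 \<and> f (- (real n powr \<alpha>)) = 0"
    and "\<And>n::nat. fourier f (real n powr \<alpha>) = 0 \<and> fourier f (- (real n powr \<alpha>)) = 0"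
  shows "\<forall>x. f x = 0"
proof -
  note f = assms(3) and zeros = assms(4,5)
  \<comment> \<open>This turns the bound on \<open>\<alpha>\<close> into
    \<open>\<alpha> \<le> 1 / 3\<close>, because
    \<open>1 - sqrt 2 / 2 \<le> 1 - 2 / 3\<close>.\<close>
  have "4 / 3 \<le> sqrt 2" by (rule real_le_rsqrt) (simp add: power2_eq_square)
  then have \<alpha>: "0 < \<alpha>" "\<alpha> \<le> 1 / 3" using assms(1,2) by auto
  define g where "g = fourier f"
  have fg: "fourier g x = f (- x)" for x by (simp add: g_def fourier_fourier_schwartz[OF f])
  have mf: "finite_moments f" and mg: "finite_moments g"
    using f by (simp_all add: g_def finite_moments_schwartz finite_moments_fourier_schwartz)
  have moment_fg: "moment j (fourier g) = moment j f" for j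
    unfolding moment_def fg
    using lborel_integral_real_affine[of "-1" "\<lambda>x. \<bar>x\<bar> ^ j * norm (f x)" 0] by simp
  have mfg: "finite_moments (fourier g)"
    using mf integrable_reflect_iff[of "\<lambda>t. \<bar>t\<bar> ^ _ * norm (f t)"] finite_moments_fourier_measurable[OF mg]
    by (simp add: finite_moments_def fg)
  have zeros_g: "fourier g (real n powr \<alpha>) = 0 \<and> fourier g (- (real n powr \<alpha>)) = 0" for n :: nat
    using zeros by (simp add: fg)
  let ?P = "LINT x|lborel. inverse (1 + x\<^sup>2) :: real"
  \<comment> \<open>The moments of \<open>f\<close> are bounded through those of \<open>g\<close>
    and conversely, so their sum satisfies a closed recursion.\<close>
  have "\<exists>D\<ge>1. \<forall>j. moment j f + moment j g \<le> D ^ (2 * j + 1)"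
  proof (rule exponential_growth_of_halving_recursion)
    fix j k :: nat assume jk: "j + 2 \<le> 2 * k"
    show "moment j f + moment j g \<le> (moment 0 f + moment 0 g) + 4 * ?P * (2 * pi) ^ k * (moment k f + moment k g)"
      using moment_fourier_le_of_power_zeros[OF \<alpha> mf mg[unfolded g_def] zeros(2) jk]
        moment_fourier_le_of_power_zeros[OF \<alpha> mg mfg zeros_g jk]
      by (simp add: moment_fg g_def[symmetric] algebra_simps)
  qed (auto simp: moment_nonneg intro!: add_nonneg_nonneg integral_nonneg_AE mult_nonneg_nonneg)
  then obtain D where D: "1 \<le> D" "\<And>j. moment j f + moment j g \<le> D ^ (2 * j + 1)" by blast
  \<comment> \<open>The vanishing criterion is applied to \<open>g\<close>, whose transform is the
    reflection of \<open>f\<close>; the bound on the sum bounds the moments of \<open>g\<close>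
    because those of \<open>f\<close> are nonnegative.\<close>
  have "fourier g x = 0" for x
    by (rule fourier_eq_0_of_exponential_moments[OF \<alpha> mg zeros_g D(1)])
      (use D(2) moment_nonneg in \<open>smt (verit)\<close>)
  then show ?thesis using fg by (metis minus_minus)
qed

end
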